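(* Let $k,n \in \mathbb{N}$ with $k \leq n$, let $d$ be an angle distance on $\mathrm{Gr}(k,n)$ and let $\alpha > 0$. Then \[ N^d_{\alpha}(k, n) \leq \binom{\binom{n+1}{2} + k - 1}{k}, \] where $N^d_\alpha(k,n)$ is the maximum size of a set $H \subseteq \mathrm{Gr}(k,n)$ such that $d(U,V) = \alpha$ for all $U \neq V$ in $H$.
   Context: $\mathbb{N}$ denotes the positive integers. $\mathrm{Gr}(k,n)$ is the set of all $k$-dimensional linear subspaces of $\mathbb{R}^n$ (with the standard inner product). Principal angles: for $U,V \in \mathrm{Gr}(k,n)$ the $k$ principal angles $0 \leq \theta_1 \leq \dots \leq \theta_k \leq \pi/2$ between $U$ and $V$ are defined recursively: choose unit vectors $u \in U$, $v \in V$ maximizing $\langle u, v\rangle$ and set $\theta_1 = \arccos \langle u, v \rangle$; then $\theta_2,\dots,\theta_k$ are the principal angles between the $(k-1)$-dimensional subspaces $\{u' \in U : u' \perp u\}$ and $\{v' \in V : v' \perp v\}$. Equivalently, if $\mathbf{U}, \mathbf{V}$ are $n \times k$ matrices whose columns form orthonormal bases of $U$ and $V$, then $\cos\theta_1, \dots, \cos\theta_k$ are the singular values of $\mathbf{U}^{\intercal}\mathbf{V}$ (with multiplicity), i.e. $\cos^2\theta_1,\dots,\cos^2\theta_k$ are the eigenvalues of $\mathbf{V}^{\intercal}\mathbf{U}\mathbf{U}^{\intercal}\mathbf{V}$. Write $\theta_i(U,V)$ for the $i$-th principal angle. Angle distance: a function $d : \mathrm{Gr}(k,n)^2 \to \mathbb{R}$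 is called an angle distance if $d(U,V) \in \{\theta_1(U,V), \dots, \theta_k(U,V)\}$ for all $U,V \in \mathrm{Gr}(k,n)$. *)

theory Defs
  imports "HOL-Analysis.Analysis" "HOL-Library.Extended_Nat"
begin

definition Gr :: "nat \<Rightarrow> 'a::euclidean_space set set" where
  "Gr k = {U. subspace U \<and> dim U = k}"

definition maximal_unit_pair :: "'a::euclidean_space set \<Rightarrow> 'a set \<Rightarrow> 'a \<Rightarrow> 'a \<Rightarrow> bool" where
  "maximal_unit_pair U V u v \<longleftrightarrow>
     u \<in> U \<and> v \<in> V \<and> norm u = 1 \<and> norm v = 1 \<and>
     (\<forall>u'\<in>U. \<forall>v'\<in>V. norm u' = 1 \<longrightarrow> norm v' = 1 \<longrightarrow> u' \<bullet> v' \<le> u \<bullet> v)"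

text \<open>A list is related to \<open>U\<close> and \<open>V\<close> if it results from some sequence of choices of maximising
  pairs in the recursion.\<close>

inductive principal_angle_list :: "'a::euclidean_space set \<Rightarrow> 'a set \<Rightarrow> real list \<Rightarrow> bool" where
  Nil: "principal_angle_list {0} {0} []"
| Cons: "maximal_unit_pair U V u v \<Longrightarrow>
         principal_angle_list {u' \<in> U. orthogonal u' u} {v' \<in> V. orthogonal v' v} \<theta>s \<Longrightarrow>
         principal_angle_list U V (arccos (u \<bullet> v) # \<theta>s)"

text \<open>The list does not depend on the choices of maximising pairs (its cosines are the singular
  values of the orthogonal projection of \<open>V\<close> onto \<open>U\<close>), so \<open>SOME\<close> merely names it.
  Existence is shown below. Indices start at 1.\<close>

definition principal_angle :: "nat \<Rightarrow> 'a::euclidean_space set \<Rightarrow> 'a set \<Rightarrow> real" where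
  "principal_angle i U V = (SOME \<theta>s. principal_angle_list U V \<theta>s) ! (i - 1)"

definition angle_distance ::
    "nat \<Rightarrow> ('a::euclidean_space set \<Rightarrow> 'a set \<Rightarrow> real) \<Rightarrow> bool" where
  "angle_distance k d \<longleftrightarrow>
     (\<forall>U\<in>Gr k. \<forall>V\<in>Gr k. d U V \<in> (\<lambda>i. principal_angle i U V) ` {1..k})"

definition equidistant_set ::
    "('a::euclidean_space set \<Rightarrow> 'a set \<Rightarrow> real) \<Rightarrow> real \<Rightarrow> nat \<Rightarrow> 'a set set \<Rightarrow> bool" where
  "equidistant_set d \<alpha> k H \<longleftrightarrow>
     H \<subseteq> Gr k \<and> (\<forall>U\<in>H. \<forall>V\<in>H. U \<noteq> V \<longrightarrow> d U V = \<alpha>)"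

text \<open>The supremum is taken in \<^typ>\<open>enat\<close>, with infinite sets counted as \<open>\<infinity>\<close>, so that a finite bound
  on it also excludes infinite sets; when the supremum is finite it is attained.
  The ambient dimension is carried by the type of \<open>d\<close>.\<close>

definition max_equidistant ::
    "('a::euclidean_space set \<Rightarrow> 'a set \<Rightarrow> real) \<Rightarrow> real \<Rightarrow> nat \<Rightarrow> enat" where
  "max_equidistant d \<alpha> k =
     (SUP H \<in> {H. equidistant_set d \<alpha> k H}. if finite H then enat (card H) else \<infinity>)"

lemma maximal_unit_pair_exists:
  fixes U V :: "'a::euclidean_space set"
  assumes "subspace U" "subspace V" "dim U > 0" "dim V > 0"
  shows "\<exists>u v. maximal_unit_pair U V u v"
proof -
  have ne: "\<exists>x\<in>W. norm x = 1" if "subspace W" "dim W > 0" for W :: "'a set"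
  proof -
    have "\<not> W \<subseteq> {0}"
      using that(2) dim_eq_0 by (metis less_irrefl)
    then obtain w where "w \<in> W" "w \<noteq> 0" by blast
    then have "(1 / norm w) *\<^sub>R w \<in> W" "norm ((1 / norm w) *\<^sub>R w) = 1"
      using that(1) by (auto simp: subspace_scale)
    then show ?thesis by blast
  qed
  have cpt: "compact {x \<in> W. norm x = 1}" if "subspace W" for W :: "'a set"
  proof -
    have "{x \<in> W. norm x = 1} = W \<inter> sphere 0 1" by auto
    then show ?thesis
      using closed_subspace[OF that] by (simp add: closed_Int_compact)
  qed
  let ?S = "{x \<in> U. norm x = 1} \<times> {x \<in> V. norm x = 1}"
  have "\<exists>x\<in>?S. \<forall>y\<in>?S. fst y \<bullet> snd y \<le> fst x \<bullet> snd x"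
  proof (rule continuous_attains_sup)
    show "compact ?S" using assms cpt by (intro compact_Times) auto
    show "?S \<noteq> {}" using assms ne[of U] ne[of V] by blast
    show "continuous_on ?S (\<lambda>x. fst x \<bullet> snd x)" by (intro continuous_intros)
  qed
  then show ?thesis
    unfolding maximal_unit_pair_def by fastforce
qed

lemma principal_angle_list_length:
  "principal_angle_list U V \<theta>s \<Longrightarrow> subspace U \<Longrightarrow> length \<theta>s = dim U"
proof (induction rule: principal_angle_list.induct)
  case Nil
  then show ?case by simp
next
  case (Cons U V u v \<theta>s)
  have u: "u \<in> U" "u \<noteq> 0"
    using Cons.hyps by (auto simp: maximal_unit_pair_def)
  have eq: "{y \<in> U. \<forall>x\<in>span {u}. orthogonal x y} = {u' \<in> U. orthogonal u' u}"
    by (auto simp: span_singleton orthogonal_def inner_commute)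
  have sub: "subspace {u' \<in> U. orthogonal u' u}"
    using Cons.prems by (auto simp: subspace_def orthogonal_def inner_left_distrib)
  have "dim {u' \<in> U. orthogonal u' u} + dim (span {u}) = dim U"
    unfolding eq[symmetric]
    by (rule dim_subspace_orthogonal_to_vectors)
       (use Cons.prems u in \<open>simp_all add: span_minimal\<close>)
  then show ?case using Cons.IH[OF sub] u by simp
qed

lemma principal_angle_list_exists:
  fixes U V :: "'a::euclidean_space set"
  assumes "U \<in> Gr k" "V \<in> Gr k"
  shows "\<exists>\<theta>s. principal_angle_list U V \<theta>s"
  using assms
proof (induction k arbitrary: U V)
  case 0
  then have "U = {0}" "V = {0}"
    by (auto simp: Gr_def subspace_0)
  then show ?case using principal_angle_list.Nil by blast
next
  case (Suc k)
  then obtain u v where uv: "maximal_unit_pair U V u v"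
    using maximal_unit_pair_exists[of U V] by (auto simp: Gr_def)
  have step: "{w' \<in> W. orthogonal w' w} \<in> Gr k"
    if "W \<in> Gr (Suc k)" "w \<in> W" "norm w = 1" for W :: "'a set" and w
  proof -
    have W: "subspace W" "dim W = Suc k" using that by (auto simp: Gr_def)
    have eq: "{y \<in> W. \<forall>x\<in>span {w}. orthogonal x y} = {w' \<in> W. orthogonal w' w}"
      by (auto simp: span_singleton orthogonal_def inner_commute)
    have "dim {w' \<in> W. orthogonal w' w} + dim (span {w}) = dim W"
      unfolding eq[symmetric]
      by (rule dim_subspace_orthogonal_to_vectors)
         (use W that in \<open>simp_all add: span_minimal\<close>)
    moreover have "w \<noteq> 0" using that by auto
    moreover have "subspace {w' \<in> W. orthogonal w' w}"
      using W by (auto simp: subspace_def orthogonal_def inner_left_distrib)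
    ultimately show ?thesis using W by (auto simp: Gr_def)
  qed
  have "{u' \<in> U. orthogonal u' u} \<in> Gr k" "{v' \<in> V. orthogonal v' v} \<in> Gr k"
    using uv Suc.prems by (auto simp: maximal_unit_pair_def intro: step)
  from Suc.IH[OF this] obtain \<theta>s
    where "principal_angle_list {u' \<in> U. orthogonal u' u} {v' \<in> V. orthogonal v' v} \<theta>s"
    by blast
  then show ?case using principal_angle_list.Cons[OF uv] by blast
qed

end

theory Submission
  imports Defs "Jordan_Normal_Form.Determinant"
begin

text \<open>
  Identify a subspace \<open>U\<close> with its orthogonal projection \<open>P\<close>, a symmetric operator, hence a point in
  a space of dimension \<open>(n + 1) choose 2\<close>. The squared cosines of the principal angles between \<open>U\<close>
  and \<open>V\<close> are the eigenvalues of the compression of \<open>P\<close> to \<open>V\<close>. So if \<open>c\<close> is an orthonormal frame of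
  \<open>V\<close> and \<open>\<mu> = (cos \<alpha>)\<^sup>2\<close>, the determinant of the \<open>k \<times> k\<close> matrix with entries
  \<open>c i \<bullet> P (c j) - \<mu> \<delta>\<^sub>i\<^sub>j\<close> vanishes as soon as some principal angle between \<open>U\<close> and \<open>V\<close> equals \<open>\<alpha>\<close>
  (lemmas \<open>principal_angle_singular_pair\<close> and \<open>det_angle_matrix_eq_0\<close>), whereas for \<open>U = V\<close> it is \<open>(1 - \<mu>)^k\<close>, which is nonzero because
  \<open>0 < \<alpha> \<le> \<pi> / 2\<close>.

  Since \<open>P\<close> has trace \<open>k\<close>, the scalar \<open>\<mu>\<close> may be replaced by \<open>\<mu> / k\<close> times the trace of \<open>P\<close>. This makes
  every entry of the matrix a linear form in \<open>P\<close>, and the determinant a homogeneous polynomial of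
  degree \<open>k\<close> in \<open>(n + 1) choose 2\<close> variables (lemma \<open>det_angle_matrix_polynomial\<close>). Each \<open>V\<close> in an
  equidistant set thus gives such a polynomial, nonzero at the projection of \<open>V\<close> and zero at those of
  all other members. The polynomials are linearly independent, so there are at most as many of them
  as monomials of degree \<open>k\<close> (lemma \<open>card_le_if_diagonal_factorization\<close>).

  Both variables and monomials are indexed by multisets: by symmetry, the matrix entry of \<open>P\<close> at basis
  vectors \<open>a\<close> and \<open>a'\<close> depends only on \<open>{#a, a'#}\<close>, and a monomial of degree \<open>k\<close> is a multiset of \<open>k\<close>
  variables. The two binomial coefficients in the bound both count multisets.
\<close>

(* From here on, the dot and orthogonality are those of Euclidean space. *)
hide_const (open) Matrix.orthogonal
hide_fact (open) Matrix.orthogonal_def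
no_notation scalar_prod (infix "\<bullet>" 70)

section \<open>Principal angles as singular values\<close>

text \<open>The two families of equations say that \<open>v\<close> projects to \<open>\<sigma> u\<close> in \<open>U\<close> and \<open>u\<close> to \<open>\<sigma> v\<close> in \<open>V\<close>,
  so \<open>\<sigma>\<^sup>2\<close> is an eigenvalue of the projection onto \<open>U\<close> followed by the one onto \<open>V\<close>. Unlike
  maximality, this survives the passage from the orthogonal complements in the recursion back to
  \<open>U\<close> and \<open>V\<close>.\<close>

definition singular_pair ::
    "'a::euclidean_space set \<Rightarrow> 'a set \<Rightarrow> real \<Rightarrow> 'a \<Rightarrow> 'a \<Rightarrow> bool" where
  "singular_pair U V \<sigma> u v \<longleftrightarrow>
     u \<in> U \<and> v \<in> V \<and> norm u = 1 \<and> norm v = 1 \<and>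
     (\<forall>x\<in>U. x \<bullet> v = \<sigma> * (x \<bullet> u)) \<and> (\<forall>y\<in>V. u \<bullet> y = \<sigma> * (v \<bullet> y))"

lemma singular_pairD:
  assumes "singular_pair U V \<sigma> u v"
  shows "u \<in> U" "v \<in> V" "norm u = 1" "norm v = 1"
    and "\<And>x. x \<in> U \<Longrightarrow> x \<bullet> v = \<sigma> * (x \<bullet> u)"
    and "\<And>y. y \<in> V \<Longrightarrow> u \<bullet> y = \<sigma> * (v \<bullet> y)"
  using assms unfolding singular_pair_def by blast+

lemma maximal_unit_pair_inner_nonneg:
  assumes "maximal_unit_pair U V u v" "subspace U"
  shows "u \<bullet> v \<ge> 0"
proof -
  have "- u \<in> U" "norm (- u) = 1"
    using assms by (auto simp: maximal_unit_pair_def subspace_neg)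
  then have "(- u) \<bullet> v \<le> u \<bullet> v"
    using assms(1) unfolding maximal_unit_pair_def by blast
  then show ?thesis by simp
qed

text \<open>Let \<open>p\<close> be the projection of \<open>v\<close> onto \<open>U\<close>. Comparing \<open>u\<close> with the normalisation of \<open>p\<close> gives
  \<open>norm p \<le> u \<bullet> v\<close>, and \<open>u \<bullet> v = u \<bullet> p\<close>; this is the equality case of Cauchy--Schwarz for \<open>u\<close> and \<open>p\<close>,
  so \<open>p = (u \<bullet> v) u\<close>.\<close>

lemma inner_eq_if_maximal_on_unit_sphere:
  fixes U :: "'a::euclidean_space set"
  assumes U: "subspace U" "u \<in> U" "norm u = 1" and nonneg: "u \<bullet> v \<ge> 0"
    and max: "\<And>x. x \<in> U \<Longrightarrow> norm x = 1 \<Longrightarrow> x \<bullet> v \<le> u \<bullet> v"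
    and x: "x \<in> U"
  shows "x \<bullet> v = (u \<bullet> v) * (x \<bullet> u)"
proof -
  obtain p z where p: "p \<in> span U" and z: "\<And>w. w \<in> span U \<Longrightarrow> orthogonal z w"
    and v: "v = p + z"
    using orthogonal_subspace_decomp_exists[of U v] by metis
  have pU: "p \<in> U" using p U(1) by (simp add: span_eq_iff[THEN iffD2])
  have inner_v: "w \<bullet> v = w \<bullet> p" if "w \<in> U" for w
    using z[of w] that by (simp add: v orthogonal_def inner_right_distrib inner_commute span_base)
  have "norm p \<le> u \<bullet> v"
  proof (cases "p = 0")
    case False
    have "((1 / norm p) *\<^sub>R p) \<bullet> v \<le> u \<bullet> v"
      using False pU U(1) by (intro max) (auto simp: subspace_scale)
    moreover have "((1 / norm p) *\<^sub>R p) \<bullet> v = norm p"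
      using False inner_v[OF pU] by (simp add: dot_square_norm power2_eq_square)
    ultimately show ?thesis by simp
  qed (use nonneg in simp)
  then have "(norm p)\<^sup>2 \<le> (u \<bullet> v)\<^sup>2" by (simp add: power_mono)
  moreover have "(norm (p - (u \<bullet> v) *\<^sub>R u))\<^sup>2 = (norm p)\<^sup>2 - (u \<bullet> v)\<^sup>2"
  proof -
    have "u \<bullet> u = 1" using U(3) by (simp add: dot_square_norm)
    then show ?thesis
      unfolding power2_norm_eq_inner inner_v[OF U(2)]
      by (simp add: inner_diff_left inner_diff_right inner_commute[of u p] power2_eq_square
          algebra_simps)
  qed
  ultimately have "(norm (p - (u \<bullet> v) *\<^sub>R u))\<^sup>2 \<le> 0" by linarith
  then have "p = (u \<bullet> v) *\<^sub>R u" by simp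
  then have "x \<bullet> p = (u \<bullet> v) * (x \<bullet> u)" by (metis inner_scaleR_right)
  then show ?thesis using inner_v[OF x] by simp
qed

lemma maximal_unit_pair_imp_singular_pair:
  assumes "maximal_unit_pair U V u v" "subspace U" "subspace V"
  shows "singular_pair U V (u \<bullet> v) u v"
proof -
  note nonneg = maximal_unit_pair_inner_nonneg[OF assms(1,2)]
  have uv: "u \<in> U" "v \<in> V" "norm u = 1" "norm v = 1"
    and max: "\<And>x y. x \<in> U \<Longrightarrow> y \<in> V \<Longrightarrow> norm x = 1 \<Longrightarrow> norm y = 1 \<Longrightarrow> x \<bullet> y \<le> u \<bullet> v"
    using assms(1) by (auto simp: maximal_unit_pair_def)
  have "x \<bullet> v = (u \<bullet> v) * (x \<bullet> u)" if "x \<in> U" for x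
    by (rule inner_eq_if_maximal_on_unit_sphere[OF assms(2) uv(1,3) nonneg max[OF _ uv(2) _ uv(4)]
          that])
  moreover have "u \<bullet> y = (u \<bullet> v) * (v \<bullet> y)" if "y \<in> V" for y
  proof -
    have "x \<bullet> u \<le> v \<bullet> u" if "x \<in> V" "norm x = 1" for x
      using max[OF uv(1) that(1) uv(3) that(2)] by (simp only: inner_commute[of _ u])
    moreover have "v \<bullet> u \<ge> 0" using nonneg by (simp only: inner_commute[of v u])
    ultimately have "y \<bullet> u = (v \<bullet> u) * (y \<bullet> v)"
      using inner_eq_if_maximal_on_unit_sphere[OF assms(3) uv(2,4) _ _ \<open>y \<in> V\<close>, of u] by blast
    then show ?thesis by (simp only: inner_commute[of _ u] inner_commute[of y v])
  qed
  ultimately show ?thesis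
    unfolding singular_pair_def using uv by blast
qed

text \<open>The equations of the smaller pair are only known on the complement of \<open>u\<close> in \<open>U\<close> and of \<open>v\<close> in
  \<open>V\<close>. They extend to \<open>u\<close> and \<open>v\<close> themselves because both sides vanish there: the larger pair gives
  \<open>u \<bullet> v' = s (v \<bullet> v') = 0\<close>, and likewise \<open>u' \<bullet> v = 0\<close>.\<close>

lemma singular_pair_of_complements:
  assumes top: "singular_pair U V s u v" and UV: "subspace U" "subspace V"
    and sub: "singular_pair {x \<in> U. orthogonal x u} {y \<in> V. orthogonal y v} \<sigma> u' v'"
  shows "singular_pair U V \<sigma> u' v'"
proof -
  have u: "u \<in> U" "u \<bullet> u = 1" and v: "v \<in> V" "v \<bullet> v = 1"
    using singular_pairD(1-4)[OF top] by (simp_all add: dot_square_norm)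
  have u': "u' \<in> U" "u' \<bullet> u = 0" and v': "v' \<in> V" "v' \<bullet> v = 0"
    using singular_pairD(1,2)[OF sub] by (simp_all add: orthogonal_def)
  have uv': "u \<bullet> v' = 0" and u'v: "u' \<bullet> v = 0"
    using singular_pairD(6)[OF top v'(1)] singular_pairD(5)[OF top u'(1)] u'(2) v'(2)
    by (simp_all add: inner_commute[of v v'])
  have "x \<bullet> v' = \<sigma> * (x \<bullet> u')" if "x \<in> U" for x
  proof -
    have "x - (x \<bullet> u) *\<^sub>R u \<in> {x \<in> U. orthogonal x u}"
      using that u UV by (simp add: orthogonal_def inner_diff_left subspace_diff subspace_scale)
    from singular_pairD(5)[OF sub this] show ?thesis
      using uv' u' by (simp add: inner_diff_left inner_commute[of u u'])
  qed
  moreover have "u' \<bullet> y = \<sigma> * (v' \<bullet> y)" if "y \<in> V" for y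
  proof -
    have "y - (y \<bullet> v) *\<^sub>R v \<in> {y \<in> V. orthogonal y v}"
      using that v UV by (simp add: orthogonal_def inner_diff_left subspace_diff subspace_scale)
    from singular_pairD(6)[OF sub this] show ?thesis
      using u'v v' by (simp add: inner_diff_right)
  qed
  ultimately show ?thesis
    using u'(1) v'(1) singular_pairD(3,4)[OF sub] by (simp add: singular_pair_def)
qed

lemma principal_angle_list_singular_pair:
  assumes "principal_angle_list U V \<theta>s" "subspace U" "subspace V" "\<theta> \<in> set \<theta>s"
  shows "0 \<le> \<theta> \<and> \<theta> \<le> pi / 2 \<and> (\<exists>u v. singular_pair U V (cos \<theta>) u v)"
  using assms
proof (induction rule: principal_angle_list.induct)
  case (Cons U V u v \<theta>s)
  have sp: "singular_pair U V (u \<bullet> v) u v"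
    using Cons maximal_unit_pair_imp_singular_pair by blast
  have sub: "subspace {x \<in> W. orthogonal x w}" if "subspace W" for W :: "'a set" and w
    using that by (auto simp: subspace_def orthogonal_def inner_left_distrib)
  show ?case
  proof (cases "\<theta> \<in> set \<theta>s")
    case True
    then have "0 \<le> \<theta> \<and> \<theta> \<le> pi / 2 \<and> (\<exists>u' v'. singular_pair {x \<in> U. orthogonal x u}
        {y \<in> V. orthogonal y v} (cos \<theta>) u' v')"
      using Cons sub by blast
    then show ?thesis
      using singular_pair_of_complements[OF sp] Cons.prems by blast
  next
    case False
    then have \<theta>: "\<theta> = arccos (u \<bullet> v)" using Cons.prems by simp
    have "0 \<le> u \<bullet> v" using maximal_unit_pair_inner_nonneg Cons by blast
    moreover have "u \<bullet> v \<le> 1"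
      using norm_cauchy_schwarz[of u v] singular_pairD(3,4)[OF sp] by simp
    ultimately have "cos \<theta> = u \<bullet> v" "0 \<le> \<theta>" "\<theta> \<le> pi / 2"
      unfolding \<theta> using arccos_le_pi2[of "u \<bullet> v"] by (simp_all add: cos_arccos arccos_lbound)
    then show ?thesis using sp by metis
  qed
qed simp

lemma principal_angle_singular_pair:
  assumes "U \<in> Gr k" "V \<in> Gr k" "i \<in> {1..k}"
  shows "0 \<le> principal_angle i U V \<and> principal_angle i U V \<le> pi / 2 \<and>
    (\<exists>u v. singular_pair U V (cos (principal_angle i U V)) u v)"
proof -
  define \<theta>s where "\<theta>s = (SOME \<theta>s. principal_angle_list U V \<theta>s)"
  have pal: "principal_angle_list U V \<theta>s"
    unfolding \<theta>s_def using principal_angle_list_exists[OF assms(1,2)] by (rule someI_ex)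
  have UV: "subspace U" "subspace V" "dim U = k" using assms by (auto simp: Gr_def)
  have "length \<theta>s = k" using principal_angle_list_length[OF pal] UV by simp
  then have "principal_angle i U V \<in> set \<theta>s"
    using assms(3) by (auto simp: principal_angle_def \<theta>s_def[symmetric])
  from principal_angle_list_singular_pair[OF pal UV(1,2) this] show ?thesis .
qed

section \<open>A rank bound\<close>

text \<open>The hypotheses factor an invertible diagonal matrix indexed by \<open>S\<close> through the index set \<open>J\<close>, so
  its rank is at most \<open>card J\<close>.\<close>

lemma card_le_if_diagonal_factorization:
  fixes c :: "'a \<Rightarrow> 'j \<Rightarrow> 'f::field" and m :: "'j \<Rightarrow> 'a \<Rightarrow> 'f"
  assumes "finite S" "finite J"
    and off: "\<And>V U. V \<in> S \<Longrightarrow> U \<in> S \<Longrightarrow> U \<noteq> V \<Longrightarrow> (\<Sum>j\<in>J. c V j * m j U) = 0"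
    and diag: "\<And>V. V \<in> S \<Longrightarrow> (\<Sum>j\<in>J. c V j * m j V) \<noteq> 0"
  shows "card S \<le> card J"
proof (rule ccontr)
  assume "\<not> card S \<le> card J"
  then have less: "card J < card S" by simp
  define n r where "n = card S" and "r = card J"
  obtain s where s: "bij_betw s {0..<n} S"
    using ex_bij_betw_nat_finite[OF assms(1)] n_def by blast
  obtain e where e: "bij_betw e {0..<r} J"
    using ex_bij_betw_nat_finite[OF assms(2)] r_def by blast
  (* Both factors are padded with zeros to square matrices; since r < n, the padding of C is at least
     one zero column, so C is singular although C * D is not. *)
  define C where "C = Matrix.mat n n (\<lambda>(i, j). if j < r then c (s i) (e j) else 0)"
  define D where "D = Matrix.mat n n (\<lambda>(j, i). if j < r then m (e j) (s i) else 0)"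
  have carrier: "C \<in> carrier_mat n n" "D \<in> carrier_mat n n" by (auto simp: C_def D_def)
  have entry: "(C * D) $$ (i, j) = (\<Sum>x\<in>J. c (s i) x * m x (s j))" if "i < n" "j < n" for i j
  proof -
    have "(C * D) $$ (i, j) =
        (\<Sum>l\<in>{0..<n}. (if l < r then c (s i) (e l) * m (e l) (s j) else 0))"
      using that by (auto simp: C_def D_def scalar_prod_def intro!: sum.cong)
    also have "\<dots> = (\<Sum>l\<in>{0..<r}. c (s i) (e l) * m (e l) (s j))"
      using less by (intro sum.mono_neutral_cong_right) (auto simp: n_def r_def)
    also have "\<dots> = (\<Sum>x\<in>J. c (s i) x * m x (s j))"
      by (rule sum.reindex_bij_betw[OF e])
    finally show ?thesis .
  qed
  have sS: "s i \<in> S" if "i < n" for i using s that by (auto simp: bij_betw_def)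
  have s_inj: "s i \<noteq> s j" if "i < n" "j < n" "i \<noteq> j" for i j
    using s that by (auto simp: bij_betw_def inj_on_def)
  have "Determinant.det (C * D) = prod_list (diag_mat (C * D))"
    using carrier by (intro det_upper_triangular[of _ n])
      (auto simp: entry sS s_inj off intro!: upper_triangularI)
  moreover have "0 \<notin> set (diag_mat (C * D))"
  proof
    assume "0 \<in> set (diag_mat (C * D))"
    then obtain i where "i < n" "(C * D) $$ (i, i) = 0"
      unfolding diag_mat_def using carrier by (metis (no_types, lifting) atLeastLessThan_iff
          carrier_matD(1) imageE index_mult_mat(2) set_map set_upt)
    then show False using diag[OF sS] entry by metis
  qed
  ultimately have "Determinant.det (C * D) \<noteq> 0" by (metis prod_list_zero_iff)
  then have "Determinant.det C \<noteq> 0" unfolding det_mult[OF carrier] by simp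
  moreover have "C *\<^sub>v unit_vec n r = 0\<^sub>v n"
    using less by (auto simp: C_def n_def[symmetric] r_def[symmetric] intro!: eq_vecI)
  then have "Determinant.det C = 0"
    using less carrier(1) unfolding n_def[symmetric] r_def[symmetric]
    by (subst det_0_iff_vec_prod_zero_field[of _ n])
       (auto intro!: exI[of _ "unit_vec n r"] simp: unit_vec_nonzero)
  ultimately show False by simp
qed

section \<open>Determinants of linear forms\<close>

text \<open>The right-hand side is the general homogeneous polynomial of degree \<open>k\<close> in variables indexed by
  \<open>E\<close>, with a multiset \<open>M\<close> as the exponent vector of a monomial. The coefficients are the same for
  all values \<open>\<phi>\<close> of the variables.\<close>

lemma det_of_linear_forms:
  fixes L :: "nat \<Rightarrow> nat \<Rightarrow> 'e \<Rightarrow> 'r::comm_ring_1"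
  assumes "finite E"
  shows "\<exists>c. \<forall>\<phi>. Determinant.det (Matrix.mat k k (\<lambda>(i, j). \<Sum>e\<in>E. L i j e * \<phi> e)) =
     (\<Sum>M\<in>multisets_of_size E k. c M * (\<Prod>e\<in>#M. \<phi> e))"
proof -
  (* Expanding a product of k sums amounts to choosing one variable g i from each row i; choices with
     the same multiset of values give the same monomial. *)
  define G where "G = (PiE {0..<k} (\<lambda>_. E))"
  define \<tau> where "\<tau> g = image_mset g (mset_set {0..<k})" for g :: "nat \<Rightarrow> 'e"
  define P where "P = {\<pi>. \<pi> permutes {0..<k}}"
  define a where "a g = (\<Sum>\<pi>\<in>P. signof \<pi> * (\<Prod>i = 0..<k. L i (\<pi> i) (g i)))" for g
  define c where "c M = (\<Sum>g | g \<in> G \<and> \<tau> g = M. a g)" for M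
  have finG: "finite G" unfolding G_def using assms by (intro finite_PiE) auto
  have "Determinant.det (Matrix.mat k k (\<lambda>(i, j). \<Sum>e\<in>E. L i j e * \<phi> e)) =
     (\<Sum>M\<in>multisets_of_size E k. c M * (\<Prod>e\<in>#M. \<phi> e))" for \<phi>
  proof -
    have "Determinant.det (Matrix.mat k k (\<lambda>(i, j). \<Sum>e\<in>E. L i j e * \<phi> e)) =
        (\<Sum>\<pi>\<in>P. signof \<pi> * (\<Prod>i = 0..<k. \<Sum>e\<in>E. L i (\<pi> i) e * \<phi> e))"
      unfolding P_def
      by (subst det_def'[of _ k]) (auto intro!: sum.cong prod.cong arg_cong2[of _ _ _ _ "(*)"])
    also have "\<dots> = (\<Sum>\<pi>\<in>P. signof \<pi> * (\<Sum>g\<in>G. \<Prod>i = 0..<k. L i (\<pi> i) (g i) * \<phi> (g i)))"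
      unfolding G_def using assms by (subst prod_sum_PiE) auto
    also have "\<dots> = (\<Sum>g\<in>G. a g * (\<Prod>i = 0..<k. \<phi> (g i)))"
      unfolding a_def sum_distrib_left sum_distrib_right prod.distrib
      by (subst sum.swap) (simp add: mult.assoc)
    also have "\<dots> = (\<Sum>g\<in>G. a g * (\<Prod>e\<in>#\<tau> g. \<phi> e))"
      by (simp add: \<tau>_def image_mset.compositionality o_def prod_unfold_prod_mset)
    also have "\<dots> = (\<Sum>M\<in>multisets_of_size E k. \<Sum>g | g \<in> G \<and> \<tau> g = M. a g * (\<Prod>e\<in>#\<tau> g. \<phi> e))"
      using finG assms finite_multisets_of_size[OF assms]
      by (intro sum.group[symmetric]) (auto simp: G_def \<tau>_def multisets_of_size_def)
    also have "\<dots> = (\<Sum>M\<in>multisets_of_size E k. c M * (\<Prod>e\<in>#M. \<phi> e))"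
      by (auto simp: c_def sum_distrib_right intro!: sum.cong)
    finally show ?thesis .
  qed
  then show ?thesis by blast
qed

text \<open>This turns the entries of a symmetric form into values of variables indexed by unordered pairs,
  of which there are \<open>(n + 1) choose 2\<close> rather than \<open>n\<^sup>2\<close>.\<close>

lemma symmetric_factors_through_multiset:
  assumes "\<And>a b. p a b = p b a"
  shows "\<exists>\<phi>. \<forall>a b. p a b = \<phi> {#a, b#}"
proof -
  define \<phi> where "\<phi> e = (let (a, b) = (SOME (a, b). e = {#a, b#}) in p a b)" for e
  have "p a b = \<phi> {#a, b#}" for a b
  proof -
    obtain a' b' where ab: "(SOME (a', b'). {#a, b#} = {#a', b'#}) = (a', b')"
      by fastforce
    have "case (SOME (a', b'). {#a, b#} = {#a', b'#}) of (a', b') \<Rightarrow> {#a, b#} = {#a', b'#}"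
      by (rule someI[of _ "(a, b)"]) simp
    then have "{#a, b#} = {#a', b'#}" unfolding ab by simp
    then have "(a = a' \<and> b = b') \<or> (a = b' \<and> b = a')"
      by (auto simp: add_eq_conv_ex)
    then show ?thesis using assms by (auto simp: \<phi>_def ab)
  qed
  then show ?thesis by blast
qed

lemma sum_over_unordered_pairs:
  fixes L :: "'b \<Rightarrow> 'b \<Rightarrow> 'r::comm_semiring_1"
  assumes "finite B"
  shows "(\<Sum>a\<in>B. \<Sum>b\<in>B. L a b * \<phi> {#a, b#}) =
    (\<Sum>e\<in>multisets_of_size B 2. (\<Sum>(a, b) | (a, b) \<in> B \<times> B \<and> {#a, b#} = e. L a b) * \<phi> e)"
proof -
  let ?t = "\<lambda>(a, b). {#a, b#}"
  have "(\<Sum>a\<in>B. \<Sum>b\<in>B. L a b * \<phi> {#a, b#}) = (\<Sum>x\<in>B \<times> B. (case x of (a, b) \<Rightarrow> L a b) * \<phi> (?t x))"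
    by (simp add: sum.cartesian_product case_prod_beta)
  also have "\<dots> = (\<Sum>e\<in>multisets_of_size B 2. \<Sum>x | x \<in> B \<times> B \<and> ?t x = e.
      (case x of (a, b) \<Rightarrow> L a b) * \<phi> (?t x))"
    using assms finite_multisets_of_size[OF assms]
    by (intro sum.group[symmetric]) (auto simp: multisets_of_size_def)
  also have "\<dots> = (\<Sum>e\<in>multisets_of_size B 2.
      (\<Sum>x | x \<in> B \<times> B \<and> ?t x = e. (case x of (a, b) \<Rightarrow> L a b)) * \<phi> e)"
    by (auto simp: sum_distrib_right intro!: sum.cong)
  finally show ?thesis by (simp add: case_prod_beta' mem_Times_iff)
qed

section \<open>Orthonormal frames and projection forms\<close>

definition orthonormal_frame :: "nat \<Rightarrow> 'a::euclidean_space set \<Rightarrow> (nat \<Rightarrow> 'a) \<Rightarrow> bool" where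
  "orthonormal_frame k U b \<longleftrightarrow>
     (\<forall>i<k. \<forall>j<k. b i \<bullet> b j = (if i = j then 1 else 0)) \<and> span (b ` {0..<k}) = U"

lemma orthonormal_frame_exists:
  fixes U :: "'a::euclidean_space set"
  assumes "U \<in> Gr k"
  shows "\<exists>b. orthonormal_frame k U b"
proof -
  have U: "subspace U" "dim U = k" using assms by (auto simp: Gr_def)
  obtain B where B: "pairwise orthogonal B" "\<And>x. x \<in> B \<Longrightarrow> norm x = 1"
      "independent B" "card B = k" "span B = U"
    using orthonormal_basis_subspace[OF U(1)] U(2) by metis
  obtain b where b: "bij_betw b {0..<k} B"
    using ex_bij_betw_nat_finite[of B] independent_imp_finite[OF B(3)] B(4) by blast
  have "b i \<bullet> b j = (if i = j then 1 else 0)" if "i < k" "j < k" for i j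
  proof -
    have "b i \<in> B" "b j \<in> B" "i \<noteq> j \<Longrightarrow> b i \<noteq> b j"
      using b that by (auto simp: bij_betw_def inj_on_def)
    then show ?thesis
      using B(1,2) by (auto simp: pairwise_def orthogonal_def dot_square_norm)
  qed
  moreover have "span (b ` {0..<k}) = U" using b B(5) by (simp add: bij_betw_def)
  ultimately show ?thesis unfolding orthonormal_frame_def by blast
qed

lemma orthonormal_frame_expand:
  assumes "orthonormal_frame k U b" "u \<in> U"
  shows "(\<Sum>i = 0..<k. (b i \<bullet> u) *\<^sub>R b i) = u"
proof -
  have "u \<in> span (b ` {0..<k})" using assms by (simp add: orthonormal_frame_def)
  then show ?thesis
  proof (induction rule: span_induct_alt)
    case (step c x y)
    then obtain j where j: "j < k" "x = b j" by auto
    have "(\<Sum>i = 0..<k. (b i \<bullet> x) *\<^sub>R b i) = (\<Sum>i = 0..<k. if i = j then b i else 0)"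
      using assms(1) j by (intro sum.cong) (auto simp: orthonormal_frame_def)
    also have "\<dots> = x" using j by simp
    finally have "(\<Sum>i = 0..<k. (b i \<bullet> x) *\<^sub>R b i) = x" .
    then have "c *\<^sub>R (\<Sum>i = 0..<k. (b i \<bullet> x) *\<^sub>R b i) = c *\<^sub>R x" by simp
    with step show ?case
      by (simp add: inner_right_distrib scaleR_left_distrib sum.distrib scaleR_sum_right)
  qed simp
qed

text \<open>The bilinear form \<open>x \<bullet> P y\<close> of the orthogonal projection \<open>P\<close> onto the span of the frame.\<close>

definition proj_form :: "nat \<Rightarrow> (nat \<Rightarrow> 'a::euclidean_space) \<Rightarrow> 'a \<Rightarrow> 'a \<Rightarrow> real" where
  "proj_form k b x y = (\<Sum>i = 0..<k. (x \<bullet> b i) * (b i \<bullet> y))"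

lemma proj_form_commute: "proj_form k b x y = proj_form k b y x"
  by (simp add: proj_form_def inner_commute mult.commute)

lemma proj_form_right_in:
  assumes "orthonormal_frame k U b" "u \<in> U"
  shows "proj_form k b x u = x \<bullet> u"
proof -
  have "x \<bullet> u = x \<bullet> (\<Sum>i = 0..<k. (b i \<bullet> u) *\<^sub>R b i)"
    using orthonormal_frame_expand[OF assms] by simp
  also have "\<dots> = proj_form k b x u"
    by (simp add: proj_form_def inner_sum_right mult.commute)
  finally show ?thesis by simp
qed

lemma proj_form_sum_right:
  "proj_form k b x (\<Sum>j\<in>J. f j *\<^sub>R y j) = (\<Sum>j\<in>J. f j * proj_form k b x (y j))"
  unfolding proj_form_def inner_sum_right sum_distrib_left
  by (subst sum.swap) (simp add: algebra_simps)

lemma proj_form_expand_Basis: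
  "proj_form k b x y = (\<Sum>a\<in>Basis. \<Sum>a'\<in>Basis. ((x \<bullet> a) * (y \<bullet> a')) * proj_form k b a a')"
proof -
  have "proj_form k b z y = (\<Sum>a'\<in>Basis. (y \<bullet> a') * proj_form k b z a')" for z
    using proj_form_sum_right[of k b z "\<lambda>a. y \<bullet> a" "\<lambda>a. a" Basis]
    by (simp add: euclidean_representation)
  moreover have "proj_form k b x y = (\<Sum>a\<in>Basis. (x \<bullet> a) * proj_form k b a y)"
    using proj_form_sum_right[of k b y "\<lambda>a. x \<bullet> a" "\<lambda>a. a" Basis]
    by (simp add: euclidean_representation proj_form_commute)
  ultimately show ?thesis by (simp add: sum_distrib_left mult.assoc)
qed

lemma proj_form_trace:
  assumes "orthonormal_frame k U b"
  shows "(\<Sum>a\<in>Basis. proj_form k b a a) = real k"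
proof -
  have "(\<Sum>a\<in>Basis. proj_form k b a a) = (\<Sum>i = 0..<k. \<Sum>a\<in>Basis. (b i \<bullet> a) * (b i \<bullet> a))"
    unfolding proj_form_def by (subst sum.swap) (simp add: inner_commute)
  also have "\<dots> = (\<Sum>i = 0..<k. b i \<bullet> b i)"
    by (simp add: euclidean_inner[symmetric])
  also have "\<dots> = real k" using assms by (simp add: orthonormal_frame_def)
  finally show ?thesis .
qed

section \<open>The annihilating polynomials\<close>

text \<open>If \<open>b\<close> is an orthonormal frame, the trace in the diagonal entries has the value \<open>k\<close> and the
  subtracted term is just \<open>\<mu>\<close>. It is spelled out to make the entries homogeneous of degree 1 in the projection form.\<close>

definition angle_matrix ::
    "nat \<Rightarrow> real \<Rightarrow> (nat \<Rightarrow> 'a::euclidean_space) \<Rightarrow> (nat \<Rightarrow> 'a) \<Rightarrow> real mat" where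
  "angle_matrix k \<mu> b c = Matrix.mat k k (\<lambda>(i, j). proj_form k b (c i) (c j) -
     (if i = j then \<mu> / real k * (\<Sum>a\<in>Basis. proj_form k b a a) else 0))"

lemma angle_matrix_eq:
  assumes "orthonormal_frame k U b"
  shows "angle_matrix k \<mu> b c =
    Matrix.mat k k (\<lambda>(i, j). proj_form k b (c i) (c j) - (if i = j then \<mu> else 0))"
  unfolding angle_matrix_def proj_form_trace[OF assms] by (rule cong_mat) auto

text \<open>The coordinates of \<open>v\<close> in the frame \<open>c\<close> form a kernel vector: projecting \<open>v\<close> to \<open>U\<close> gives \<open>\<sigma> u\<close>, and
  projecting that to \<open>V\<close> gives \<open>\<sigma>\<^sup>2 v\<close>.\<close>

lemma det_angle_matrix_eq_0:
  assumes b: "orthonormal_frame k U b" and c: "orthonormal_frame k V c"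
    and sp: "singular_pair U V \<sigma> u v"
  shows "Determinant.det (angle_matrix k (\<sigma>\<^sup>2) b c) = 0"
proof -
  have uv: "u \<in> U" "v \<in> V" "norm v = 1" using sp by (auto simp: singular_pair_def)
  have expand: "(\<Sum>j = 0..<k. (c j \<bullet> v) *\<^sub>R c j) = v"
    by (rule orthonormal_frame_expand[OF c uv(2)])
  have cV: "c i \<in> V" if "i < k" for i
    using c that by (auto simp: orthonormal_frame_def span_base)
  have bU: "b i \<in> U" if "i < k" for i
    using b that by (auto simp: orthonormal_frame_def span_base)
  have eig: "proj_form k b (c i) v = \<sigma>\<^sup>2 * (c i \<bullet> v)" if "i < k" for i
  proof -
    have "proj_form k b (c i) v = \<sigma> * proj_form k b (c i) u"
      using singular_pairD(5)[OF sp bU]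
      by (simp add: proj_form_def sum_distrib_left mult.left_commute)
    also have "proj_form k b (c i) u = c i \<bullet> u" by (rule proj_form_right_in[OF b uv(1)])
    also have "\<dots> = \<sigma> * (c i \<bullet> v)"
      using singular_pairD(6)[OF sp cV[OF that]] by (simp add: inner_commute)
    finally show ?thesis by (simp add: power2_eq_square)
  qed
  define w where "w = Matrix.vec k (\<lambda>j. c j \<bullet> v)"
  let ?A = "angle_matrix k (\<sigma>\<^sup>2) b c"
  have "w \<noteq> 0\<^sub>v k"
  proof
    assume "w = 0\<^sub>v k"
    then have "c j \<bullet> v = 0" if "j < k" for j
      using that by (metis w_def index_vec index_zero_vec(1))
    then have "v = 0" using expand by simp
    then show False using uv by simp
  qed
  moreover have "?A *\<^sub>v w = 0\<^sub>v k"
  proof (rule eq_vecI)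
    fix i assume "i < dim_vec (0\<^sub>v k :: real Matrix.vec)"
    then have i: "i < k" by simp
    have "vec_index (?A *\<^sub>v w) i =
        (\<Sum>j = 0..<k. (proj_form k b (c i) (c j) - (if i = j then \<sigma>\<^sup>2 else 0)) * (c j \<bullet> v))"
      using i by (simp add: angle_matrix_eq[OF b] w_def scalar_prod_def)
    also have "\<dots> = (\<Sum>j = 0..<k. (c j \<bullet> v) * proj_form k b (c i) (c j)) -
        (\<Sum>j = 0..<k. if i = j then \<sigma>\<^sup>2 * (c j \<bullet> v) else 0)"
      unfolding sum_subtractf[symmetric] by (intro sum.cong) (auto simp: algebra_simps)
    also have "\<dots> = proj_form k b (c i) v - \<sigma>\<^sup>2 * (c i \<bullet> v)"
      unfolding proj_form_sum_right[symmetric] expand using i by simp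
    also have "\<dots> = 0" using eig[OF i] by simp
    finally show "vec_index (?A *\<^sub>v w) i = vec_index (0\<^sub>v k) i" using i by simp
  qed (simp add: angle_matrix_def)
  ultimately show ?thesis
    by (subst det_0_iff_vec_prod_zero_field[of _ k])
       (auto simp: angle_matrix_def w_def intro!: exI[of _ w])
qed

lemma det_angle_matrix_self:
  assumes b: "orthonormal_frame k U b"
  shows "Determinant.det (angle_matrix k \<mu> b b) = (1 - \<mu>) ^ k"
proof -
  have "proj_form k b (b i) (b j) = (if i = j then 1 else 0)" if "i < k" "j < k" for i j
  proof -
    have "b j \<in> U" using b that by (auto simp: orthonormal_frame_def span_base)
    then show ?thesis using proj_form_right_in[OF b] b that by (simp add: orthonormal_frame_def)
  qed
  then have "angle_matrix k \<mu> b b = (1 - \<mu>) \<cdot>\<^sub>m 1\<^sub>m k"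
    unfolding angle_matrix_eq[OF b] by (intro eq_matI) auto
  then show ?thesis by simp
qed

text \<open>The coefficients \<open>q\<close> depend only on the frame \<open>c\<close> of \<open>V\<close>, while \<open>U\<close>, through its frame \<open>b\<close>, enters only
  by the values \<open>\<phi>\<close> of its projection form. This separates \<open>V\<close> from \<open>U\<close> as the rank bound requires.\<close>

lemma det_angle_matrix_polynomial:
  fixes c :: "nat \<Rightarrow> 'a::euclidean_space"
  shows "\<exists>q. \<forall>b \<phi>. (\<forall>x y. proj_form k b x y = \<phi> {#x, y#}) \<longrightarrow>
    Determinant.det (angle_matrix k \<mu> b c) =
      (\<Sum>M\<in>multisets_of_size (multisets_of_size Basis 2) k. q M * (\<Prod>e\<in>#M. \<phi> e))"
proof -
  (* The coefficient of the (a, a') entry of the projection form in the (i, j) entry of the matrix. *)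
  define L where "L i j a a' = (c i \<bullet> a) * (c j \<bullet> a') -
      (if i = j then if a = a' then \<mu> / real k else 0 else 0)" for i j a a'
  define L' where
    "L' i j e = (\<Sum>(a, a') | (a, a') \<in> Basis \<times> Basis \<and> {#a, a'#} = e. L i j a a')" for i j e
  obtain q where q: "\<And>\<phi>. Determinant.det (Matrix.mat k k
      (\<lambda>(i, j). \<Sum>e\<in>multisets_of_size Basis 2. L' i j e * \<phi> e)) =
      (\<Sum>M\<in>multisets_of_size (multisets_of_size Basis 2) k. q M * (\<Prod>e\<in>#M. \<phi> e))"
    using det_of_linear_forms[of "multisets_of_size (Basis :: 'a set) 2" k L']
    by (auto simp: finite_multisets_of_size)
  have "Determinant.det (angle_matrix k \<mu> b c) =
      (\<Sum>M\<in>multisets_of_size (multisets_of_size Basis 2) k. q M * (\<Prod>e\<in>#M. \<phi> e))"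
    if \<phi>: "\<And>x y. proj_form k b x y = \<phi> {#x, y#}" for b \<phi>
  proof -
    have "proj_form k b (c i) (c j) -
        (if i = j then \<mu> / real k * (\<Sum>a\<in>Basis. proj_form k b a a) else 0) =
        (\<Sum>e\<in>multisets_of_size Basis 2. L' i j e * \<phi> e)" for i j
    proof -
      have "(\<Sum>a\<in>Basis. \<Sum>a'\<in>Basis. (if i = j then if a = a' then \<mu> / real k else 0 else 0) *
          proj_form k b a a') =
          (if i = j then \<mu> / real k * (\<Sum>a\<in>Basis. proj_form k b a a) else 0)"
        by (simp add: sum_distrib_left if_distrib[of "\<lambda>x. x * _"] cong: if_cong)
      then have "proj_form k b (c i) (c j) -
          (if i = j then \<mu> / real k * (\<Sum>a\<in>Basis. proj_form k b a a) else 0) =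
          (\<Sum>a\<in>Basis. \<Sum>a'\<in>Basis. L i j a a' * proj_form k b a a')"
        by (subst proj_form_expand_Basis) (simp add: L_def left_diff_distrib sum_subtractf)
      also have "\<dots> = (\<Sum>e\<in>multisets_of_size Basis 2. L' i j e * \<phi> e)"
        unfolding \<phi> L'_def by (rule sum_over_unordered_pairs) simp
      finally show ?thesis .
    qed
    then show ?thesis unfolding angle_matrix_def by (simp add: q)
  qed
  then show ?thesis by blast
qed

section \<open>The bound\<close>

lemma card_le_if_common_singular_value:
  fixes S :: "'a::euclidean_space set set"
  assumes S: "finite S" "S \<subseteq> Gr k" and \<sigma>: "\<sigma>\<^sup>2 \<noteq> 1"
    and sp: "\<And>U V. U \<in> S \<Longrightarrow> V \<in> S \<Longrightarrow> U \<noteq> V \<Longrightarrow> \<exists>u v. singular_pair U V \<sigma> u v"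
  shows "card S \<le> (((DIM('a) + 1) choose 2) + k - 1) choose k"
proof -
  let ?J = "multisets_of_size (multisets_of_size (Basis :: 'a set) 2) k"
  have "\<forall>U\<in>S. \<exists>b. orthonormal_frame k U b" using S(2) orthonormal_frame_exists by blast
  then obtain b where b: "\<And>U. U \<in> S \<Longrightarrow> orthonormal_frame k U (b U)" by metis
  have "\<exists>\<phi>. \<forall>x y. proj_form k (b U) x y = \<phi> {#x, y#}" for U
    by (rule symmetric_factors_through_multiset) (rule proj_form_commute)
  then obtain \<phi> where \<phi>: "\<And>U x y. proj_form k (b U) x y = \<phi> U {#x, y#}" by metis
  have "\<forall>V. \<exists>q. \<forall>U. Determinant.det (angle_matrix k (\<sigma>\<^sup>2) (b U) (b V)) =
      (\<Sum>M\<in>?J. q M * (\<Prod>e\<in>#M. \<phi> U e))"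
  proof
    fix V
    show "\<exists>q. \<forall>U. Determinant.det (angle_matrix k (\<sigma>\<^sup>2) (b U) (b V)) =
        (\<Sum>M\<in>?J. q M * (\<Prod>e\<in>#M. \<phi> U e))"
      using det_angle_matrix_polynomial[of k "\<sigma>\<^sup>2" "b V"] \<phi> by meson
  qed
  then obtain q where q: "\<And>V U. Determinant.det (angle_matrix k (\<sigma>\<^sup>2) (b U) (b V)) =
      (\<Sum>M\<in>?J. q V M * (\<Prod>e\<in>#M. \<phi> U e))" by metis
  have "card S \<le> card ?J"
  proof (rule card_le_if_diagonal_factorization[where c = q and m = "\<lambda>M U. \<Prod>e\<in>#M. \<phi> U e"])
    show "(\<Sum>M\<in>?J. q V M * (\<Prod>e\<in>#M. \<phi> U e)) = 0" if VU: "V \<in> S" "U \<in> S" "U \<noteq> V" for V U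
      using sp[OF VU(2,1,3)] det_angle_matrix_eq_0[OF b[OF VU(2)] b[OF VU(1)]]
      unfolding q[symmetric] by blast
    show "(\<Sum>M\<in>?J. q V M * (\<Prod>e\<in>#M. \<phi> V e)) \<noteq> 0" if "V \<in> S" for V
      unfolding q[symmetric] det_angle_matrix_self[OF b[OF that]] using \<sigma> by simp
  qed (use S in \<open>auto simp: finite_multisets_of_size\<close>)
  then show ?thesis by (simp add: card_multisets_of_size finite_multisets_of_size)
qed

theorem theorem1:
  fixes k :: nat and \<alpha> :: real
    and d :: "(real ^ 'n) set \<Rightarrow> (real ^ 'n) set \<Rightarrow> real"
  assumes "1 \<le> k" and "k \<le> CARD('n)"
    and "angle_distance k d"
    and "\<alpha> > 0"
  shows "max_equidistant d \<alpha> k \<le> enat ((((CARD('n) + 1) choose 2) + k - 1) choose k)"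
proof -
  define N where "N = ((((CARD('n) + 1) choose 2) + k - 1) choose k)"
  have N_pos: "1 \<le> N"
  proof -
    have "1 \<le> (CARD('n) + 1) choose 2" using assms(1,2)
      by (simp add: Suc_le_eq zero_less_binomial_iff)
    then have "k \<le> ((CARD('n) + 1) choose 2) + k - 1" by linarith
    then show ?thesis unfolding N_def using zero_less_binomial by (metis One_nat_def Suc_leI)
  qed
  have bound: "card S \<le> N" if H: "equidistant_set d \<alpha> k H" and S: "S \<subseteq> H" "finite S" for H S
  proof (cases "\<exists>U\<in>S. \<exists>V\<in>S. U \<noteq> V")
    case False
    (* With at most one member, no pair constrains \<alpha>, which may then even be \<pi>, where the squared
       cosine is 1. *)
    then have "card S \<le> 1" using S(2) by (auto simp: card_le_Suc0_iff_eq)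
    then show ?thesis using N_pos by simp
  next
    case True
    have Gr: "S \<subseteq> Gr k" using H S by (auto simp: equidistant_set_def)
    have sp: "\<alpha> \<le> pi / 2 \<and> (\<exists>u v. singular_pair U V (cos \<alpha>) u v)"
      if UV: "U \<in> S" "V \<in> S" "U \<noteq> V" for U V
    proof -
      have "d U V = \<alpha>" using H S UV unfolding equidistant_set_def by blast
      moreover have "U \<in> Gr k" "V \<in> Gr k" using Gr UV by auto
      ultimately obtain i where "i \<in> {1..k}" "\<alpha> = principal_angle i U V"
        using assms(3) unfolding angle_distance_def by blast
      then show ?thesis
        using principal_angle_singular_pair[OF \<open>U \<in> Gr k\<close> \<open>V \<in> Gr k\<close>] by blast
    qed
    have "\<alpha> \<le> pi / 2" using True sp by blast
    then have "0 \<le> cos \<alpha>" "cos \<alpha> < 1"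
      using assms(4) cos_ge_zero[of \<alpha>] cos_monotone_0_pi[of 0 \<alpha>] by auto
    then have "(cos \<alpha>)\<^sup>2 \<noteq> 1" by (auto simp: power2_eq_1_iff)
    from card_le_if_common_singular_value[OF S(2) Gr this] sp show ?thesis
      by (simp add: N_def)
  qed
  have "(if finite H then enat (card H) else \<infinity>) \<le> enat N" if H: "equidistant_set d \<alpha> k H" for H
  proof -
    have "finite H"
    proof (rule ccontr)
      assume "infinite H"
      then obtain S where "S \<subseteq> H" "finite S" "card S = Suc N"
        using infinite_arbitrarily_large by blast
      then show False using bound[OF H, of S] by simp
    qed
    then show ?thesis using bound[OF H, of H] by simp
  qed
  then show ?thesis unfolding max_equidistant_def N_def by (intro SUP_least) blast
qed

end
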